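(* $\vec{C}_3(1,2,2)$ is not a hero in oriented complete multipartite graphs.
   Context: An oriented complete multipartite graph is an orientation (each edge given exactly one direction) of a complete multipartite graph. The dichromatic number $\vec{\chi}(D)$ is the least number of parts in a partition of $V(D)$ into sets inducing acyclic subdigraphs. A digraph $H$ is a hero in a class $\mathcal{C}$ if there is a constant $c$ such that every digraph in $\mathcal{C}$ with no induced subdigraph isomorphic to $H$ has dichromatic number at most $c$. For digraphs $D_1,D_2,D_3$, $\vec{C}_3(D_1,D_2,D_3)$ is the digraph obtained from their disjoint union by adding all arcs from $D_1$ to $D_2$, from $D_2$ to $D_3$ and from $D_3$ to $D_1$; an integer $k$ in this notation stands for the transitive tournament $TT_k$ on $k$ vertices. Thus $\vec{C}_3(1,2,2)$ is the 5-vertex tournament with vertices $x, y_1,y_2,z_1,z_2$ and arcs $y_1y_2$, $z_1z_2$, $xy_i$, $y_iz_j$, $z_jx$ for all $i,j\in\{1,2\}$. *)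

theory Defs
  imports "Graph_Theory.Graph_Theory" "HOL-Library.Disjoint_Sets"
begin

text \<open>
  Digraphs without parallel arcs are pair digraphs; \<^locale>\<open>pair_digraph\<close> adds finiteness and
  the absence of loops. As in the underlying library, an undirected graph is a symmetric digraph
  (\<^locale>\<open>pair_graph\<close>).
\<close>

definition complete_multipartite :: "'a pair_pre_digraph \<Rightarrow> bool" where
  "complete_multipartite G \<longleftrightarrow> pair_graph G \<and>
    (\<exists>P. partition_on (pverts G) P \<and>
      parcs G = {(u, v). \<exists>A\<in>P. \<exists>B\<in>P. A \<noteq> B \<and> u \<in> A \<and> v \<in> B})"

definition orientation_of :: "'a pair_pre_digraph \<Rightarrow> 'a pair_pre_digraph \<Rightarrow> bool" where
  "orientation_of D G \<longleftrightarrow> pair_digraph D \<and> pverts D = pverts G \<and> parcs D \<subseteq> parcs G \<and>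
    (\<forall>(u, v)\<in>parcs G. (u, v) \<in> parcs D \<longleftrightarrow> (v, u) \<notin> parcs D)"

definition oriented_complete_multipartite :: "'a pair_pre_digraph set" where
  "oriented_complete_multipartite = {D. \<exists>G. complete_multipartite G \<and> orientation_of D G}"

definition acyclic_digraph :: "('a, 'b) pre_digraph \<Rightarrow> bool" where
  "acyclic_digraph D \<longleftrightarrow> \<not> (\<exists>p. pre_digraph.cycle D p)"

definition dichromatic_number :: "('a, 'b) pre_digraph \<Rightarrow> nat" where
  "dichromatic_number D =
    (LEAST k. \<exists>P. partition_on (verts D) P \<and> finite P \<and> card P = k \<and>
      (\<forall>S\<in>P. acyclic_digraph (D \<restriction> S)))"

definition contains_induced :: "('a, 'b) pre_digraph \<Rightarrow> ('c, 'd) pre_digraph \<Rightarrow> bool" where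
  "contains_induced D H \<longleftrightarrow> (\<exists>K. induced_subgraph K D \<and> digraph_iso K H)"

text \<open>
  The class is given by its members on the vertex type \<open>'a\<close>. For an isomorphism-closed class of
  finite digraphs nothing is lost by taking \<open>'a = nat\<close>.
\<close>

definition hero_in :: "'h pair_pre_digraph \<Rightarrow> 'a pair_pre_digraph set \<Rightarrow> bool" where
  "hero_in H \<C> \<longleftrightarrow>
    (\<exists>c. \<forall>D\<in>\<C>. \<not> contains_induced (with_proj D) (with_proj H) \<longrightarrow>
      dichromatic_number (with_proj D) \<le> c)"

definition TT :: "nat \<Rightarrow> nat pair_pre_digraph" where
  "TT k = \<lparr>pverts = {..<k}, parcs = {(i, j). i < j \<and> j < k}\<rparr>"

definition C3 :: "'a pair_pre_digraph \<Rightarrow> 'b pair_pre_digraph \<Rightarrow> 'c pair_pre_digraph \<Rightarrow>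
    ('a + 'b + 'c) pair_pre_digraph" where
  "C3 D1 D2 D3 =
    (let in1 = Inl; in2 = Inr \<circ> Inl; in3 = Inr \<circ> Inr;
         V1 = in1 ` pverts D1; V2 = in2 ` pverts D2; V3 = in3 ` pverts D3
     in \<lparr>pverts = V1 \<union> V2 \<union> V3,
         parcs = map_prod in1 in1 ` parcs D1 \<union> map_prod in2 in2 ` parcs D2 \<union>
           map_prod in3 in3 ` parcs D3 \<union> V1 \<times> V2 \<union> V2 \<times> V3 \<union> V3 \<times> V1\<rparr>)"

end

theory Submission
  imports Defs "HOL-Library.List_Lexorder" "HOL-Library.Sublist" "HOL-Library.Countable"
begin

text \<open>
  Let \<open>E\<close> be a finite ordered graph of large chromatic number in which no edge \<open>mn\<close> crosses both edges of
  an increasing path \<open>bcd\<close> as in \<open>b < m < c < n < d\<close>. Take the paths \<open>a < b < c\<close> of \<open>E\<close> as vertices and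
  their midpoints as parts, with all arcs pointing forwards except those between consecutive paths
  \<open>(a, b, c)\<close>, \<open>(b, c, d)\<close>. These backward arcs form the twofold shift graph of \<open>E\<close>, which still has large
  chromatic number, and a copy of \<open>C3(1,2,2)\<close> would force the forbidden crossing.

  Such a graph \<open>E\<close> is the tree of all plays of a game, ordered by preorder: the player appends
  vertices and joins each to earlier ones without creating a crossing. Against any colouring the
  player can force arbitrarily many colours, and as all plays are branches of one tree, the
  adaptive strategy becomes a lower bound for the chromatic number of \<open>E\<close>.
\<close>

section \<open>The tree of plays and its preorder\<close>

text \<open>
  A node of the tree is the list of moves that leads to it; the last move lists the depths of the
  ancestors to which the node is joined.
\<close>
definition attached :: "nat list list \<Rightarrow> nat list list \<Rightarrow> bool" where
  "attached u v \<longleftrightarrow> strict_prefix u v \<and> length u \<in> set (last v)"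

definition noncrossing :: "nat list list \<Rightarrow> bool" where
  "noncrossing h \<longleftrightarrow> (\<forall>b m c n. strict_prefix b m \<and> strict_prefix m c \<and> strict_prefix c n \<and> prefix n h
    \<longrightarrow> \<not> (attached b c \<and> attached m n))"

text \<open>Moves are lists rather than sets so that the lexicographic order on nodes is linear and
  is the preorder of the tree; the bounds by \<open>N\<close> keep the tree finite.\<close>

definition histories :: "nat \<Rightarrow> nat list list set" where
  "histories N = {h. noncrossing h \<and> length h \<le> N \<and> set h \<subseteq> sorted_list_of_set ` Pow {..N}}"

lemma strict_prefix_less: "strict_prefix u v \<Longrightarrow> u < (v :: 'a::linorder list)"
proof (induction u arbitrary: v)
  case Nil
  then show ?case by (cases v) auto
next
  case (Cons a u)
  then show ?case by (cases v) auto
qed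

text \<open>The descendants of a node are consecutive in preorder, which turns order relations back
  into ancestry.\<close>

lemma prefix_le_between:
  fixes u v w :: "'a::linorder list"
  assumes "prefix u w" "u \<le> v" "v \<le> w"
  shows "prefix u v"
  using assms
proof (induction u arbitrary: v w)
  case Nil
  then show ?case by simp
next
  case (Cons a u)
  then show ?case by (cases v; cases w) auto
qed

lemma finite_histories: "finite (histories N)"
proof (rule finite_subset)
  show "histories N \<subseteq> {h. set h \<subseteq> sorted_list_of_set ` Pow {..N} \<and> length h \<le> N}"
    by (auto simp: histories_def)
  show "finite {h. set h \<subseteq> sorted_list_of_set ` Pow {..N} \<and> length h \<le> N}"
    by (intro finite_lists_length_le finite_imageI) simp
qed

text \<open>\<open>noncrossing\<close> restricts single branches only. The edge \<open>cd\<close>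
  passing over \<open>n\<close> puts \<open>n\<close> below \<open>c\<close>, so both crossing edges
  lie on the branch of \<open>n\<close>.\<close>

lemma noncrossing_preorder:
  assumes "noncrossing n" and "attached b c" "attached c d" "attached m n"
    and "b < m" "m < c" "c < n" "n < d"
  shows False
proof -
  have mc: "prefix m c"
    using prefix_le_between[of m n c] assms by (auto simp: attached_def)
  have cn: "prefix c n"
    using prefix_le_between[of c d n] assms by (auto simp: attached_def)
  have "prefix b m"
    using prefix_le_between[of b c m] assms by (auto simp: attached_def)
  then show False
    using assms mc cn unfolding noncrossing_def strict_prefix_def by (metis order_less_irrefl prefix_order.refl)
qed

section \<open>The colouring game\<close>

text \<open>A new last node can be attached to such prefixes without crossing an edge of the
  branch.\<close>

definition uncovered :: "nat list list \<Rightarrow> nat list list \<Rightarrow> bool" where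
  "uncovered g a \<longleftrightarrow> (\<forall>b c. strict_prefix b a \<and> strict_prefix a c \<and> prefix c g \<longrightarrow> \<not> attached b c)"

text \<open>Later play does not reach back to \<open>h\<close> or beyond, so it covers no prefix of
  \<open>h\<close>.\<close>

definition separates :: "nat list list \<Rightarrow> nat list list \<Rightarrow> bool" where
  "separates h g \<longleftrightarrow> (\<forall>b c. attached b c \<and> strict_prefix h c \<and> prefix c g \<longrightarrow> strict_prefix h b)"

text \<open>
  One round of a colouring game: a new node may be attached to any set of uncovered prefixes. Playing
  the strategy for \<open>j\<close> colours twice yields either \<open>j + 1\<close> colours or twice the same \<open>j\<close> colours; in
  the latter case a node attached to the second set has a new colour and covers no prefix in the first.
\<close>
lemma uncovered_colours:
  assumes proper: "\<And>u v. v \<in> histories N \<Longrightarrow> attached u v \<Longrightarrow> f u \<noteq> f v"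
    and "h \<in> histories N" "length h + 2 ^ j \<le> Suc N"
  shows "\<exists>g A. g \<in> histories N \<and> prefix h g \<and> length g < length h + 2 ^ j \<and> separates h g \<and>
    (\<forall>a\<in>A. strict_prefix h a \<and> prefix a g \<and> uncovered g a) \<and> j \<le> card (f ` A)"
  using assms(2,3)
proof (induction j arbitrary: h)
  case 0
  then show ?case
    by (intro exI[of _ h] exI[of _ "{}"]) (auto simp: separates_def strict_prefix_def)
next
  case (Suc j)
  have "length h + 2 ^ j \<le> Suc N" using Suc.prems by simp
  from Suc.IH[OF Suc.prems(1) this] obtain g1 A1 where
    g1: "g1 \<in> histories N" "prefix h g1" "length g1 < length h + 2 ^ j" "separates h g1" and
    A1: "\<And>a. a \<in> A1 \<Longrightarrow> strict_prefix h a" "\<And>a. a \<in> A1 \<Longrightarrow> prefix a g1" "j \<le> card (f ` A1)"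
      "\<And>a. a \<in> A1 \<Longrightarrow> uncovered g1 a"
    by auto
  have "length g1 + 2 ^ j \<le> Suc N" using Suc.prems g1 by simp
  from Suc.IH[OF g1(1) this] obtain g2 A2 where
    g2: "g2 \<in> histories N" "prefix g1 g2" "length g2 < length g1 + 2 ^ j" "separates g1 g2" and
    A2: "\<And>a. a \<in> A2 \<Longrightarrow> strict_prefix g1 a" "\<And>a. a \<in> A2 \<Longrightarrow> prefix a g2" "j \<le> card (f ` A2)"
      "\<And>a. a \<in> A2 \<Longrightarrow> uncovered g2 a"
    by auto
  have fin: "finite A1" "finite A2"
    using A1(2) A2(2) by (auto intro: finite_subset[of _ "set (prefixes g1)"] finite_subset[of _ "set (prefixes g2)"])
  have hg2: "prefix h g2" using g1 g2 by (meson prefix_order.trans)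
  have split: "prefix c g1 \<or> strict_prefix g1 c" if "prefix c g2" for c
    using that g2(2) by (metis prefix_same_cases strict_prefix_def)
  have sep: "separates h g2"
    unfolding separates_def
  proof (intro allI impI; elim conjE)
    fix b c assume bc: "attached b c" "strict_prefix h c" "prefix c g2"
    from split[OF bc(3)] show "strict_prefix h b"
    proof
      assume "prefix c g1"
      then show ?thesis using bc g1(4) by (auto simp: separates_def)
    next
      assume "strict_prefix g1 c"
      then have "strict_prefix g1 b" using bc g2(4) by (auto simp: separates_def)
      then show ?thesis using g1(2) prefix_order.le_less_trans by blast
    qed
  qed
  have unc: "uncovered g2 a" if a: "a \<in> A1" for a
    unfolding uncovered_def
  proof (intro allI impI notI; elim conjE)
    fix b c assume bc: "strict_prefix b a" "strict_prefix a c" "prefix c g2" "attached b c"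
    have "strict_prefix b g1" using bc(1) A1(2)[OF a] prefix_order.less_le_trans by blast
    from split[OF bc(3)] show False
    proof
      assume "prefix c g1"
      then show False using bc A1(4)[OF a] by (auto simp: uncovered_def)
    next
      assume "strict_prefix g1 c"
      then have "strict_prefix g1 b" using bc g2(4) by (auto simp: separates_def)
      then show False using \<open>strict_prefix b g1\<close> prefix_order.less_asym by blast
    qed
  qed
  show ?case
  proof (cases "Suc j \<le> card (f ` (A1 \<union> A2))")
    case True
    show ?thesis
    proof (intro exI[of _ g2] exI[of _ "A1 \<union> A2"] conjI ballI)
      fix a assume a: "a \<in> A1 \<union> A2"
      show "strict_prefix h a"
        using a A1(1) A2(1) g1(2) prefix_order.le_less_trans by blast
      show "prefix a g2" "uncovered g2 a"
        using a A1(2) A2(2,4) g2(2) unc prefix_order.trans by blast+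
    qed (use g1 g2 hg2 True sep in auto)
  next
    case False
    have finU: "finite (f ` (A1 \<union> A2))" using fin by simp
    have "f ` A1 = f ` (A1 \<union> A2)" "f ` A2 = f ` (A1 \<union> A2)"
      using False A1(3) A2(3) by (intro card_seteq[OF finU]; auto)+
    then have same: "f ` A1 = f ` A2" by simp
    define g where "g = g2 @ [sorted_list_of_set (length ` A2)]"
    have pre: "strict_prefix b g \<longleftrightarrow> prefix b g2" for b
      unfolding g_def by (auto simp: strict_prefix_def)
    have pg: "prefix b g \<longleftrightarrow> b = g \<or> prefix b g2" for b
      unfolding g_def by auto
    \<comment> \<open>A depth determines a prefix of \<open>g2\<close>, so a move may record depths
      only.\<close>
    have att: "attached b g \<longleftrightarrow> b \<in> A2" for b
    proof
      assume "attached b g"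
      then obtain a where "prefix b g2" "a \<in> A2" "length b = length a"
        using fin unfolding attached_def pre by (auto simp: g_def)
      then have "prefix a b" "prefix b a"
        using A2(2)[of a] prefix_length_prefix[of _ g2] by auto
      then show "b \<in> A2" using \<open>a \<in> A2\<close> prefix_order.antisym by blast
    next
      assume "b \<in> A2"
      then show "attached b g" using A2(2) fin unfolding attached_def pre by (auto simp: g_def)
    qed
    have len: "length a \<le> N" if "a \<in> A2" for a
      using A2(2)[OF that] g2(1) by (auto simp: histories_def dest: prefix_length_le)
    have "noncrossing g"
      unfolding noncrossing_def
    proof (intro allI impI notI; elim conjE)
      fix b m c n
      assume H: "strict_prefix b m" "strict_prefix m c" "strict_prefix c n" "prefix n g"
        and E: "attached b c" "attached m n"
      show False
      proof (cases "n = g")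
        case True
        then have "m \<in> A2" "prefix c g2" using E H att pre by auto
        then show False using A2(4)[of m] H E by (auto simp: uncovered_def)
      next
        case False
        then have "prefix n g2" using H pg by blast
        then show False using g2(1) H E unfolding histories_def noncrossing_def by blast
      qed
    qed
    \<comment> \<open>Each of the two rounds stays strictly below its bound, which leaves room for
      the appended node.\<close>
    moreover have "length g \<le> N" "length g < length h + 2 ^ Suc j"
      using g1(3) g2(3) Suc.prems by (auto simp: g_def)
    moreover have "set g \<subseteq> sorted_list_of_set ` Pow {..N}"
      using g2(1) len by (auto simp: g_def histories_def)
    ultimately have g: "g \<in> histories N" "length g < length h + 2 ^ Suc j"
      by (auto simp: histories_def)
    have "f g \<notin> f ` A2" using proper[OF g(1)] att by (metis imageE)
    then have card: "Suc j \<le> card (f ` insert g A1)"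
      using same A1(3) fin by simp
    show ?thesis
    proof (intro exI[of _ g] exI[of _ "insert g A1"] conjI ballI)
      show "prefix h g" using hg2 pg by blast
    next
      fix a assume a: "a \<in> insert g A1"
      show "strict_prefix h a" using a A1(1) hg2 pre by blast
      show "prefix a g" using a A1(2) g2(2) pg prefix_order.trans by blast
      show "uncovered g a"
        unfolding uncovered_def
      proof (intro allI impI notI; elim conjE)
        fix b c assume bc: "strict_prefix b a" "strict_prefix a c" "prefix c g" "attached b c"
        have "strict_prefix a g" using bc(2,3) prefix_order.less_le_trans by blast
        then have a: "a \<in> A1" using a by auto
        show False
        proof (cases "c = g")
          case True
          \<comment> \<open>Edges into \<open>g\<close> start in \<open>A2\<close>, hence after
            \<open>g1\<close>, whereas \<open>a\<close> is a prefix of \<open>g1\<close>.\<close>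
          then have "strict_prefix g1 b" using bc A2(1) att by blast
          moreover have "strict_prefix b g1" using bc(1) A1(2)[OF a] prefix_order.less_le_trans by blast
          ultimately show False using prefix_order.less_asym by blast
        next
          case False
          then show False using unc[OF a] bc pg[of c] by (auto simp: uncovered_def)
        qed
      qed
    next
      show "separates h g"
        unfolding separates_def
      proof (intro allI impI; elim conjE)
        fix b c assume bc: "attached b c" "strict_prefix h c" "prefix c g"
        show "strict_prefix h b"
        proof (cases "c = g")
          case True
          then have "strict_prefix g1 b" using bc A2(1) att by blast
          then show ?thesis using g1(2) prefix_order.le_less_trans by blast
        next
          case False
          then show ?thesis using sep bc pg[of c] by (auto simp: separates_def)
        qed
      qed
    qed (use g card in auto)
  qed
qed

lemma ordered_graph_unbounded_chromatic:
  obtains E :: "(nat list list \<times> nat list list) set" where "finite E"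
    "\<And>u v. (u, v) \<in> E \<Longrightarrow> u < v"
    "\<And>b m c n d. (b, c) \<in> E \<Longrightarrow> (c, d) \<in> E \<Longrightarrow> (m, n) \<in> E \<Longrightarrow> b < m \<Longrightarrow> m < c \<Longrightarrow> c < n \<Longrightarrow> \<not> n < d"
    "\<And>(f :: nat list list \<Rightarrow> 'c) C. finite C \<Longrightarrow> card C \<le> k \<Longrightarrow> range f \<subseteq> C \<Longrightarrow> \<exists>(u, v)\<in>E. f u = f v"
proof
  \<comment> \<open>Room for a game of \<open>k + 1\<close> colours from the empty history, one more
    than is available.\<close>
  define N :: nat where "N = 2 ^ Suc k"
  define E where "E = {(u, v). v \<in> histories N \<and> attached u v}"
  have "E \<subseteq> (\<Union>v\<in>histories N. set (prefixes v) \<times> {v})"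
    by (auto simp: E_def attached_def strict_prefix_def)
  then show "finite E"
    by (rule finite_subset) (simp add: finite_histories)
  show "u < v" if "(u, v) \<in> E" for u v
    using that strict_prefix_less by (auto simp: E_def attached_def)
  show "\<not> n < d" if "(b, c) \<in> E" "(c, d) \<in> E" "(m, n) \<in> E" "b < m" "m < c" "c < n" for b m c n d
    using noncrossing_preorder[of n b c d m] that by (auto simp: E_def histories_def)
  show "\<exists>(u, v)\<in>E. f u = f v" if C: "finite C" "card C \<le> k" "range f \<subseteq> C"
    for f :: "nat list list \<Rightarrow> 'c" and C
  proof (rule ccontr)
    assume "\<not> (\<exists>(u, v)\<in>E. f u = f v)"
    then have proper: "f u \<noteq> f v" if "v \<in> histories N" "attached u v" for u v
      using that by (auto simp: E_def)
    have "[] \<in> histories N" by (auto simp: histories_def noncrossing_def strict_prefix_def)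
    from uncovered_colours[where f = f and j = "Suc k", OF proper this] obtain A where "Suc k \<le> card (f ` A)"
      by (auto simp: N_def)
    moreover have "card (f ` A) \<le> card C" using C by (intro card_mono) auto
    ultimately show False using C by simp
  qed
qed

section \<open>Acyclic partitions, parity of ranks and copies of the pattern\<close>

text \<open>\<open>LEAST\<close> needs a witness: the partition into single vertices, acyclic for
  lack of loops.\<close>

lemma dichromatic_partition:
  fixes D :: "'a pair_pre_digraph"
  assumes "finite (pverts D)" and "\<And>v. (v, v) \<notin> parcs D"
  obtains P where "partition_on (pverts D) P" "finite P" "card P = dichromatic_number (with_proj D)"
    "\<And>S. S \<in> P \<Longrightarrow> acyclic_digraph (with_proj D \<restriction> S)"
proof -
  let ?Q = "\<lambda>k. \<exists>P. partition_on (pverts D) P \<and> finite P \<and> card P = k \<and>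
      (\<forall>S\<in>P. acyclic_digraph (with_proj D \<restriction> S))"
  have acyc: "acyclic_digraph (with_proj D \<restriction> {v})" for v
  proof -
    have "arcs (with_proj D \<restriction> {v}) = {}"
      using assms(2)[of v] by (auto simp: induce_subgraph_def)
    then show ?thesis
      by (auto simp: acyclic_digraph_def pre_digraph.cycle_def pre_digraph.awalk_def
          simp del: induce_subgraph_arcs)
  qed
  have "partition_on (pverts D) ((\<lambda>v. {v}) ` pverts D)"
    by (auto simp: partition_on_def disjoint_def)
  then have "?Q (card ((\<lambda>v. {v}) ` pverts D))"
    using assms(1) acyc by blast
  then have "?Q (dichromatic_number (with_proj D))"
    unfolding dichromatic_number_def with_proj_simps by (rule LeastI)
  then show ?thesis using that by blast
qed

lemma triangle_not_acyclic:
  assumes "(u, v) \<in> parcs D" "(v, w) \<in> parcs D" "(w, u) \<in> parcs D"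
    and "{u, v, w} \<subseteq> S" "distinct [u, v, w]"
  shows "\<not> acyclic_digraph (with_proj D \<restriction> S)"
proof -
  have "pre_digraph.cycle (with_proj D \<restriction> S) [(u, v), (v, w), (w, u)]"
    unfolding pre_digraph.cycle_def pre_digraph.awalk_def
    using assms
    by (intro exI[of _ u]) (auto simp: pre_digraph.cas.simps pre_digraph.awalk_verts.simps induce_subgraph_def)
  then show ?thesis by (auto simp: acyclic_digraph_def)
qed

text \<open>If \<open>M\<close> had no element in between, the rank of \<open>c\<close> would exceed
  that of \<open>b\<close> by exactly one, on account of \<open>b\<close> itself.\<close>

lemma exists_between_if_same_parity:
  fixes M :: "'a::linorder set"
  assumes "finite M" "b \<in> M" "b < c"
    and "even (card {m \<in> M. m < b}) \<longleftrightarrow> even (card {m \<in> M. m < c})"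
  shows "\<exists>m\<in>M. b < m \<and> m < c"
proof (rule ccontr)
  assume "\<not> ?thesis"
  then have "{m \<in> M. m < c} = insert b {m \<in> M. m < b}"
    using assms(2,3) by (auto simp: not_less le_less)
  then show False using assms by simp
qed

lemma contains_C3_122:
  assumes "contains_induced (with_proj D) (with_proj (C3 (TT 1) (TT 2) (TT 2)))"
  obtains x y y' z z' where
    "(x, y) \<in> parcs D" "(x, y') \<in> parcs D" "(y, z) \<in> parcs D" "(y, z') \<in> parcs D"
    "(y', z) \<in> parcs D" "(y', z') \<in> parcs D" "(z, x) \<in> parcs D" "(z', x) \<in> parcs D"
    "(y, y') \<in> parcs D" "(z, z') \<in> parcs D"
proof -
  let ?H = "C3 (TT 1) (TT 2) (TT 2)"
  obtain K f where K: "induced_subgraph K (with_proj D)"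
    and f: "pre_digraph.digraph_isomorphism K f" "with_proj ?H = app_iso f K"
    using assms by (auto simp: contains_induced_def digraph_iso_def)
  have K_arcs: "arcs K \<subseteq> parcs D" "tail K = fst" "head K = snd"
    using K by (auto simp: induced_subgraph_def subgraph_def compatible_def)
  have wf: "wf_digraph K" and inj: "inj_on (iso_verts f) (verts K)"
    and ends: "\<And>a. a \<in> arcs K \<Longrightarrow> iso_verts f (tail K a) = iso_tail f (iso_arcs f a) \<and>
      iso_verts f (head K a) = iso_head f (iso_arcs f a)"
    using f(1) by (auto simp: pre_digraph.digraph_isomorphism_def)
  have H_arcs: "parcs ?H = iso_arcs f ` arcs K" "iso_tail f = fst" "iso_head f = snd"
    using f(2) by (auto simp: app_iso_def with_proj_def)
  \<comment> \<open>The inverse of the vertex bijection pulls arcs of the pattern back to arcs of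
    \<open>D\<close>.\<close>
  define g where "g = the_inv_into (verts K) (iso_verts f)"
  have arc: "(g p, g q) \<in> parcs D" if "(p, q) \<in> parcs ?H" for p q
  proof -
    from that H_arcs obtain a where a: "a \<in> arcs K" "(p, q) = iso_arcs f a" by auto
    have "fst a \<in> verts K" "snd a \<in> verts K"
      using wf_digraph.wellformed[OF wf a(1)] K_arcs by auto
    moreover have "iso_verts f (fst a) = p" "iso_verts f (snd a) = q"
      using ends[OF a(1)] K_arcs H_arcs by (simp_all flip: a(2))
    ultimately have "g p = fst a" "g q = snd a"
      unfolding g_def using inj by (auto simp: the_inv_into_f_f)
    then show ?thesis using a(1) K_arcs by auto
  qed
  let ?x = "Inl 0" and ?y = "\<lambda>i. Inr (Inl i)" and ?z = "\<lambda>i. Inr (Inr i)"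
  show ?thesis
    by (rule that[of "g ?x" "g (?y 0)" "g (?y 1)" "g (?z 0)" "g (?z 1)"]; rule arc;
      force simp: C3_def TT_def Let_def image_iff map_prod_def)
qed

section \<open>The digraph on increasing paths\<close>

text \<open>
  The arcs between walks \<open>(a, b, c)\<close> point forwards in the order of the midpoints \<open>b\<close>, except
  that consecutive walks \<open>(a, b, c)\<close>, \<open>(b, c, d)\<close> are joined by a backward arc.
\<close>
fun walk_arc :: "'v::linorder \<times> 'v \<times> 'v \<Rightarrow> 'v \<times> 'v \<times> 'v \<Rightarrow> bool" where
  "walk_arc (a, b, c) (a', b', c') \<longleftrightarrow>
    b < b' \<and> \<not> (c = b' \<and> a' = b) \<or> b' < b \<and> c' = b \<and> a = b'"

lemma walk_arc_midpoints: "walk_arc s t \<Longrightarrow> fst (snd s) \<noteq> fst (snd t)"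
  by (cases s; cases t) auto

lemma walk_arc_total:
  "fst (snd s) \<noteq> fst (snd t) \<Longrightarrow> walk_arc s t \<longleftrightarrow> \<not> walk_arc t s"
  by (cases s; cases t) auto

locale uncrossed_paths_graph =
  fixes E :: "('v::{linorder,countable} \<times> 'v) set"
  assumes finite_edges: "finite E"
    and edge_less: "(u, v) \<in> E \<Longrightarrow> u < v"
    and no_crossing: "(b, c) \<in> E \<Longrightarrow> (c, d) \<in> E \<Longrightarrow> (m, n) \<in> E \<Longrightarrow>
      b < m \<Longrightarrow> m < c \<Longrightarrow> c < n \<Longrightarrow> \<not> n < d"
begin

definition walks :: "('v \<times> 'v \<times> 'v) set" where
  "walks = {(a, b, c). (a, b) \<in> E \<and> (b, c) \<in> E}"

text \<open>\<open>to_nat\<close> moves the walks to \<open>nat\<close>, the vertex type of the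
  class in the theorem.\<close>

definition walk_digraph :: "nat pair_pre_digraph" where
  "walk_digraph = \<lparr>pverts = to_nat ` walks,
    parcs = {(to_nat s, to_nat t) | s t. s \<in> walks \<and> t \<in> walks \<and> walk_arc s t}\<rparr>"

lemma finite_walks: "finite walks"
proof (rule finite_subset)
  show "walks \<subseteq> fst ` E \<times> fst ` E \<times> snd ` E" by (force simp: walks_def)
qed (use finite_edges in auto)

lemma parcs_walk_digraph [simp]:
  "(to_nat s, to_nat t) \<in> parcs walk_digraph \<longleftrightarrow> s \<in> walks \<and> t \<in> walks \<and> walk_arc s t"
  by (auto simp: walk_digraph_def inj_eq[OF inj_to_nat] simp del: split_paired_Ex)

lemma parcs_walk_digraphE:
  assumes "(u, v) \<in> parcs walk_digraph"
  obtains s t where "u = to_nat s" "v = to_nat t" "s \<in> walks" "t \<in> walks" "walk_arc s t"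
  using assms by (auto simp: walk_digraph_def)

text \<open>The parts collect the walks with equal midpoint; \<open>walk_arc_total\<close> gives
  every other pair exactly one direction.\<close>

lemma walk_digraph_multipartite: "walk_digraph \<in> oriented_complete_multipartite"
proof -
  define mid :: "'v \<times> 'v \<times> 'v \<Rightarrow> 'v" where "mid = (\<lambda>s. fst (snd s))"
  define part where "part = (\<lambda>b. to_nat ` {s \<in> walks. mid s = b})"
  define G where "G = \<lparr>pverts = to_nat ` walks,
    parcs = {(to_nat s, to_nat t) | s t. s \<in> walks \<and> t \<in> walks \<and> mid s \<noteq> mid t}\<rparr>"
  have in_part: "to_nat s \<in> part b \<longleftrightarrow> s \<in> walks \<and> mid s = b" for s b
    by (auto simp: part_def inj_eq[OF inj_to_nat])
  have part_eq: "part (mid s) = part (mid t) \<longleftrightarrow> mid s = mid t" if "s \<in> walks" for s t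
    using that in_part[of s "mid s"] in_part[of s "mid t"] by auto
  have fin: "finite (to_nat ` walks)" using finite_walks by simp
  have "parcs G \<subseteq> to_nat ` walks \<times> to_nat ` walks"
    unfolding G_def by auto
  then have "finite (parcs G)"
    by (rule finite_subset) (intro finite_cartesian_product fin)
  moreover have "parcs walk_digraph \<subseteq> to_nat ` walks \<times> to_nat ` walks"
    unfolding walk_digraph_def by auto
  then have "finite (parcs walk_digraph)"
    by (rule finite_subset) (intro finite_cartesian_product fin)
  ultimately have fins: "finite (to_nat ` walks)" "finite (parcs G)" "finite (parcs walk_digraph)"
    using fin by simp_all
  have "pair_graph G"
    using fins by unfold_locales
      (auto simp: G_def symmetric_def sym_def inj_eq[OF inj_to_nat])
  moreover have "partition_on (pverts G) ((\<lambda>s. part (mid s)) ` walks)"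
    unfolding partition_on_def disjoint_def
    by (auto simp: G_def part_def inj_eq[OF inj_to_nat])
  moreover have "parcs G = {(u, v). \<exists>A\<in>(\<lambda>s. part (mid s)) ` walks. \<exists>B\<in>(\<lambda>s. part (mid s)) ` walks.
      A \<noteq> B \<and> u \<in> A \<and> v \<in> B}"
  proof (intro set_eqI iffI; clarify)
    fix u v assume "(u, v) \<in> parcs G"
    then obtain s t where "u = to_nat s" "v = to_nat t" "s \<in> walks" "t \<in> walks" "mid s \<noteq> mid t"
      by (auto simp: G_def)
    then show "\<exists>A\<in>(\<lambda>s. part (mid s)) ` walks. \<exists>B\<in>(\<lambda>s. part (mid s)) ` walks. A \<noteq> B \<and> u \<in> A \<and> v \<in> B"
      using part_eq[of s t] in_part
      by (intro bexI[of _ "part (mid s)"] bexI[of _ "part (mid t)"]) auto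
  next
    fix u v s t assume "part (mid s) \<noteq> part (mid t)" "u \<in> part (mid s)" "v \<in> part (mid t)"
    then show "(u, v) \<in> parcs G" by (auto simp: G_def part_def)
  qed
  ultimately have "complete_multipartite G"
    unfolding complete_multipartite_def by blast
  moreover have "orientation_of walk_digraph G"
    unfolding orientation_of_def
  proof (intro conjI)
    show "pair_digraph walk_digraph"
      using fins by unfold_locales
        (auto simp: walk_digraph_def inj_eq[OF inj_to_nat] dest: walk_arc_midpoints)
    show "pverts walk_digraph = pverts G" by (simp add: G_def walk_digraph_def)
    show "parcs walk_digraph \<subseteq> parcs G"
      using walk_arc_midpoints by (fastforce simp: G_def walk_digraph_def mid_def)
    show "\<forall>(u, v)\<in>parcs G. (u, v) \<in> parcs walk_digraph \<longleftrightarrow> (v, u) \<notin> parcs walk_digraph"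
      using walk_arc_total by (auto simp: G_def mid_def)
  qed
  ultimately show ?thesis
    unfolding oriented_complete_multipartite_def by blast
qed

section \<open>Excluding copies of the pattern\<close>

text \<open>
  Among walks with distinct midpoints, each has at most one backward arc to its left and at most
  one to its right. This leaves the single order \<open>y' < z < x < y < z'\<close> of the midpoints, up to
  exchanging \<open>y\<close> with \<open>y'\<close> and \<open>z\<close> with \<open>z'\<close>, and there the arc from \<open>y\<close> back to \<open>z\<close> crosses
  the pair of backward arcs at \<open>x\<close>.
\<close>
lemma no_C3_122_walks_aux:
  assumes walks: "x \<in> walks" "y' \<in> walks" "z \<in> walks"
    and arcs: "walk_arc x y'" "walk_arc y z" "walk_arc y z'" "walk_arc y' z" "walk_arc z' x"
    and mid: "fst (snd y) \<noteq> fst (snd y')" "fst (snd z) \<noteq> fst (snd z')"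
    and yz: "fst (snd x) < fst (snd y)" "fst (snd z) < fst (snd x)"
  shows False
proof -
  obtain a1 b1 c1 where x: "x = (a1, b1, c1)" by (cases x)
  obtain a2 b2 c2 where y: "y = (a2, b2, c2)" by (cases y)
  obtain a3 b3 c3 where y': "y' = (a3, b3, c3)" by (cases y')
  obtain a4 b4 c4 where z: "z = (a4, b4, c4)" by (cases z)
  obtain a5 b5 c5 where z': "z' = (a5, b5, c5)" by (cases z')
  note A = arcs[unfolded x y y' z z' walk_arc.simps]
  have M: "b2 \<noteq> b3" "b4 \<noteq> b5" and L: "b1 < b2" "b4 < b1"
    using mid yz by (auto simp: x y y' z z')
  \<comment> \<open>As \<open>z\<close> precedes \<open>y\<close>, this arc is backward; a second
    backward arc out of \<open>y\<close> or into \<open>z\<close> would make two midpoints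
    equal.\<close>
  have zy: "c4 = b2" "a2 = b4" using A(2) L by auto
  have "\<not> b1 < b3" using A(4) L M(1) zy by auto
  then have y'x: "b3 < b1" "c3 = b1" using A(1) by auto
  have "\<not> b5 < b1" using A(3) L M(2) zy by auto
  then have xz': "b1 < b5" "c1 = b5" using A(5) by auto
  have "b3 < b4" using A(4) M(1) zy by auto
  moreover have "b2 < b5" using A(3) M(2) zy by auto
  \<comment> \<open>The three edges come from \<open>y'\<close>, \<open>x\<close> and
    \<open>z\<close>, in this order.\<close>
  ultimately show False
    using no_crossing[of b3 b1 b5 b4 b2] L zy y'x xz' walks by (auto simp: walks_def x y' z)
qed

text \<open>The entries of \<open>x\<close> fix the midpoint at the other end of a backward arc out
  of \<open>x\<close> or into it. So one of \<open>y\<close>, \<open>y'\<close> comes after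
  \<open>x\<close> and one of \<open>z\<close>, \<open>z'\<close> before it; the four cases are
  renamings of one.\<close>

lemma no_C3_122_walks:
  assumes "x \<in> walks" "y \<in> walks" "y' \<in> walks" "z \<in> walks" "z' \<in> walks"
    and arcs: "walk_arc x y" "walk_arc x y'" "walk_arc y z" "walk_arc y z'" "walk_arc y' z"
      "walk_arc y' z'" "walk_arc z x" "walk_arc z' x"
    and mid: "fst (snd y) \<noteq> fst (snd y')" "fst (snd z) \<noteq> fst (snd z')"
  shows False
proof -
  have "fst (snd x) < fst (snd y) \<or> fst (snd x) < fst (snd y')"
    using arcs(1,2) mid(1) by (cases x; cases y; cases y') auto
  moreover have "fst (snd z) < fst (snd x) \<or> fst (snd z') < fst (snd x)"
    using arcs(7,8) mid(2) by (cases x; cases z; cases z') auto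
  ultimately show False
    using no_C3_122_walks_aux[of x y' z y z'] no_C3_122_walks_aux[of x y z y' z']
      no_C3_122_walks_aux[of x y' z' y z] no_C3_122_walks_aux[of x y z' y' z] assms
    by metis
qed

lemma walk_digraph_C3_122_free:
  "\<not> contains_induced (with_proj walk_digraph) (with_proj (C3 (TT 1) (TT 2) (TT 2)))"
proof
  assume "contains_induced (with_proj walk_digraph) (with_proj (C3 (TT 1) (TT 2) (TT 2)))"
  then obtain x y y' z z' where arcs:
    "(x, y) \<in> parcs walk_digraph" "(x, y') \<in> parcs walk_digraph" "(y, z) \<in> parcs walk_digraph"
    "(y, z') \<in> parcs walk_digraph" "(y', z) \<in> parcs walk_digraph" "(y', z') \<in> parcs walk_digraph"
    "(z, x) \<in> parcs walk_digraph" "(z', x) \<in> parcs walk_digraph"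
    "(y, y') \<in> parcs walk_digraph" "(z, z') \<in> parcs walk_digraph"
    by (rule contains_C3_122) (rule that)
  obtain s :: "'v \<times> 'v \<times> 'v" where x: "x = to_nat s" using arcs(1) by (metis parcs_walk_digraphE)
  obtain t t' :: "'v \<times> 'v \<times> 'v" where y: "y = to_nat t" "y' = to_nat t'" using arcs(9) by (metis parcs_walk_digraphE)
  obtain r r' :: "'v \<times> 'v \<times> 'v" where z: "z = to_nat r" "z' = to_nat r'" using arcs(10) by (metis parcs_walk_digraphE)
  \<comment> \<open>The arcs \<open>yy'\<close> and \<open>zz'\<close> make the midpoints
    distinct.\<close>
  show False
    using arcs no_C3_122_walks[of s t t' r r'] unfolding x y z parcs_walk_digraph
    by (blast dest: walk_arc_midpoints)
qed

section \<open>Dichromatic number against the chromatic number of \<open>E\<close>\<close>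

text \<open>
  Within an acyclic set, consecutive walks \<open>(a, b, c)\<close>, \<open>(b, c, d)\<close> have no midpoint between \<open>b\<close>
  and \<open>c\<close>, as it would complete a triangle. So the parity of the rank of the midpoint separates
  them, and a colour for each walk descends to edges and vertices by taking sets of colours.
\<close>
lemma colouring_of_dichromatic:
  obtains \<chi> :: "'v \<Rightarrow> (nat set \<times> bool) set set" and C where "finite C"
    "card C = 2 ^ 2 ^ (2 * dichromatic_number (with_proj walk_digraph))" "range \<chi> \<subseteq> C"
    "\<And>u v. (u, v) \<in> E \<Longrightarrow> \<chi> u \<noteq> \<chi> v"
proof -
  have "(v, v) \<notin> parcs walk_digraph" for v
    by (auto elim!: parcs_walk_digraphE simp: inj_eq[OF inj_to_nat] dest: walk_arc_midpoints)
  then obtain P where P: "partition_on (to_nat ` walks) P" "finite P"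
      "card P = dichromatic_number (with_proj walk_digraph)"
      "\<And>S. S \<in> P \<Longrightarrow> acyclic_digraph (with_proj walk_digraph \<restriction> S)"
    using dichromatic_partition[of walk_digraph] finite_walks by (auto simp: walk_digraph_def)
  have "\<forall>s\<in>walks. \<exists>S\<in>P. to_nat s \<in> S"
    using P(1) by (auto simp: partition_on_def)
  then obtain block where block: "\<And>s. s \<in> walks \<Longrightarrow> block s \<in> P" "\<And>s. s \<in> walks \<Longrightarrow> to_nat s \<in> block s"
    by metis
  define mids where "mids S = (\<lambda>s. fst (snd s)) ` {s \<in> walks. to_nat s \<in> S}" for S
  define \<phi> where "\<phi> s = (block s, even (card {m \<in> mids (block s). m < fst (snd s)}))" for s
  have \<phi>_neq: "\<phi> (a, b, c) \<noteq> \<phi> (b, c, d)" if E: "(a, b) \<in> E" "(b, c) \<in> E" "(c, d) \<in> E" for a b c d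
  proof
    assume eq: "\<phi> (a, b, c) = \<phi> (b, c, d)"
    define S where "S = block (a, b, c)"
    have w: "(a, b, c) \<in> walks" "(b, c, d) \<in> walks" using E by (auto simp: walks_def)
    have S: "S \<in> P" "to_nat (a, b, c) \<in> S" "to_nat (b, c, d) \<in> S" "block (b, c, d) = S"
      using block[OF w(1)] block[OF w(2)] eq by (auto simp: S_def \<phi>_def)
    have "finite (mids S)" using finite_walks by (simp add: mids_def)
    moreover have "b \<in> mids S" using w(1) S(2) by (force simp: mids_def)
    ultimately obtain m where "m \<in> mids S" "b < m" "m < c"
      using exists_between_if_same_parity[of "mids S" b c] edge_less[OF E(2)] eq S(4)
      by (auto simp: \<phi>_def S_def)
    then obtain l n where m: "(l, m, n) \<in> walks" "to_nat (l, m, n) \<in> S"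
      by (auto simp: mids_def)
    \<comment> \<open>As \<open>b < m < c\<close>, the walk at \<open>m\<close> is consecutive with
      neither of the others: two arcs lead forwards through it and one leads back.\<close>
    have "\<not> acyclic_digraph (with_proj walk_digraph \<restriction> S)"
      using w m S \<open>b < m\<close> \<open>m < c\<close> edge_less[OF E(2)]
      by (intro triangle_not_acyclic[of "to_nat (a, b, c)" "to_nat (l, m, n)" _ "to_nat (b, c, d)"])
        (auto simp: inj_eq[OF inj_to_nat])
    then show False using P(4) S(1) by blast
  qed
  \<comment> \<open>As usual for shift graphs, colours are collected over all extensions by one
    edge; equal values at adjacent vertices then yield consecutive walks of equal colour.\<close>
  define \<psi> where "\<psi> a b = {\<phi> (a, b, c) | c. (b, c) \<in> E}" for a b
  define \<chi> where "\<chi> a = {\<psi> a b | b. (a, b) \<in> E}" for a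
  show ?thesis
  proof (rule that[of "Pow (Pow (P \<times> UNIV))" \<chi>])
    show "finite (Pow (Pow (P \<times> (UNIV :: bool set))))" using P(2) by simp
    \<comment> \<open>The parity doubles the number of blocks, and each passage to sets adds an
      exponential.\<close>
    show "card (Pow (Pow (P \<times> (UNIV :: bool set)))) = 2 ^ 2 ^ (2 * dichromatic_number (with_proj walk_digraph))"
      using P(2,3) by (simp add: card_Pow card_cartesian_product mult.commute)
    have "\<phi> s \<in> P \<times> UNIV" if "s \<in> walks" for s
      using block(1)[OF that] by (simp add: \<phi>_def)
    then show "range \<chi> \<subseteq> Pow (Pow (P \<times> UNIV))"
      by (fastforce simp: \<chi>_def \<psi>_def walks_def)
    show "\<chi> a \<noteq> \<chi> b" if ab: "(a, b) \<in> E" for a b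
    proof
      assume "\<chi> a = \<chi> b"
      then have "\<psi> a b \<in> \<chi> b" using ab by (auto simp: \<chi>_def)
      then obtain c where c: "(b, c) \<in> E" "\<psi> a b = \<psi> b c" by (auto simp: \<chi>_def)
      then have "\<phi> (a, b, c) \<in> \<psi> b c" by (auto simp: \<psi>_def)
      then obtain d where "(c, d) \<in> E" "\<phi> (a, b, c) = \<phi> (b, c, d)" by (auto simp: \<psi>_def)
      then show False using \<phi>_neq ab c(1) by blast
    qed
  qed
qed

end

theorem theorem7p1p1:
  shows "\<not> hero_in (C3 (TT 1) (TT 2) (TT 2))
    (oriented_complete_multipartite :: nat pair_pre_digraph set)"
proof
  assume "hero_in (C3 (TT 1) (TT 2) (TT 2)) (oriented_complete_multipartite :: nat pair_pre_digraph set)"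
  then obtain c where c: "\<And>D :: nat pair_pre_digraph. D \<in> oriented_complete_multipartite \<Longrightarrow>
      \<not> contains_induced (with_proj D) (with_proj (C3 (TT 1) (TT 2) (TT 2))) \<Longrightarrow>
      dichromatic_number (with_proj D) \<le> c"
    by (auto simp: hero_in_def)
  obtain E :: "(nat list list \<times> nat list list) set" where E: "finite E"
    "\<And>u v. (u, v) \<in> E \<Longrightarrow> u < v"
    "\<And>b m c n d. (b, c) \<in> E \<Longrightarrow> (c, d) \<in> E \<Longrightarrow> (m, n) \<in> E \<Longrightarrow> b < m \<Longrightarrow> m < c \<Longrightarrow> c < n \<Longrightarrow> \<not> n < d"
    and chrom: "\<And>(f :: nat list list \<Rightarrow> (nat set \<times> bool) set set) C. finite C \<Longrightarrow>
      card C \<le> 2 ^ 2 ^ (2 * c) \<Longrightarrow> range f \<subseteq> C \<Longrightarrow> \<exists>(u, v)\<in>E. f u = f v"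
    \<comment> \<open>\<open>k\<close> is the number of colours that
      \<open>colouring_of_dichromatic\<close> would use at dichromatic number
      \<open>c\<close>.\<close>
    by (rule ordered_graph_unbounded_chromatic[where k = "2 ^ 2 ^ (2 * c)"]) (rule that)
  interpret uncrossed_paths_graph E
    by unfold_locales (fact E)+
  have "dichromatic_number (with_proj walk_digraph) \<le> c"
    using c walk_digraph_multipartite walk_digraph_C3_122_free by blast
  then have "(2 :: nat) ^ 2 ^ (2 * dichromatic_number (with_proj walk_digraph)) \<le> 2 ^ 2 ^ (2 * c)"
    by (intro power_increasing) auto
  moreover obtain \<chi> :: "nat list list \<Rightarrow> (nat set \<times> bool) set set" and C where "finite C"
    "card C = 2 ^ 2 ^ (2 * dichromatic_number (with_proj walk_digraph))" "range \<chi> \<subseteq> C"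
    and proper: "\<And>u v. (u, v) \<in> E \<Longrightarrow> \<chi> u \<noteq> \<chi> v"
    by (rule colouring_of_dichromatic) (rule that)
  ultimately have "\<exists>(u, v)\<in>E. \<chi> u = \<chi> v"
    by (intro chrom[of C]) auto
  then show False using proper by auto
qed

end
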